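(* Let $G$ be an infinite weighted graph with base vertex $v_0$ as described in the context. There exists a constant $A$ with $0<A<1$ such that, if $\limsup_{n\to\infty}\rho_n<A$, then there exists a constant $C>0$ with $$\|f\|^2_{L^2(\mu)}\le C\,\mathcal E(f,f)$$ for every $f\in L^2(\mu)$ with $(f,1)_{L^2(\mu)}=0$.
   Context: $G=(V_G,E_G)$ is a connected graph with countably infinite vertex and edge sets, no loops, locally finite (each $N(x)=\{y:\{x,y\}\in E_G\}$ finite), with positive rational edge weights $C_{x,y}=C_{y,x}$. Put $m(x)=\sum_{y\in N(x)}C_{x,y}$, $m(A)=\sum_{x\in A}m(x)$, assume $m(V_G)<\infty$, and let $\mu(x)=m(x)/m(V_G)$. $\mathcal E(f,f)=\sum_{\{x,y\}\in E_G}C_{x,y}(f(x)-f(y))^2$. Let $d$ be the graph distance, fix $v_0\in V_G$, $V_n=\{x:d(v_0,x)\le n\}$, $S_n=\{x:d(v_0,x)=n\}$. Let $(X_k)$ be the Markov chain with transition probabilities $p(x,y)=C_{x,y}/m(x)$ for $y\in N(x)$, and $\rho_n=\sup_{x\in S_n}P_x(X_1\notin V_{n-1})$. *)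

theory Defs
  imports "HOL-Probability.Probability"
begin

definition adj_rel :: "'v set set \<Rightarrow> ('v \<times> 'v) set" where
  "adj_rel E = {(x, y). {x, y} \<in> E}"

definition nbrs :: "'v set set \<Rightarrow> 'v \<Rightarrow> 'v set" where
  "nbrs E x = {y. {x, y} \<in> E}"

text \<open>Only meaningful when \<open>x\<close> and \<open>y\<close> are joined by a path, which is always so in the connected
  graphs considered here.\<close>

definition graph_dist :: "'v set set \<Rightarrow> 'v \<Rightarrow> 'v \<Rightarrow> nat" where
  "graph_dist E x y = (LEAST n. (x, y) \<in> adj_rel E ^^ n)"

definition dball :: "'v set \<Rightarrow> 'v set set \<Rightarrow> 'v \<Rightarrow> nat \<Rightarrow> 'v set" where
  "dball V E v0 n = {x \<in> V. graph_dist E v0 x \<le> n}"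

definition dsphere :: "'v set \<Rightarrow> 'v set set \<Rightarrow> 'v \<Rightarrow> nat \<Rightarrow> 'v set" where
  "dsphere V E v0 n = {x \<in> V. graph_dist E v0 x = n}"

text \<open>The values of \<open>C\<close> off the edges are never used.\<close>

definition vweight :: "'v set set \<Rightarrow> ('v \<Rightarrow> 'v \<Rightarrow> real) \<Rightarrow> 'v \<Rightarrow> real" where
  "vweight E C x = (\<Sum>y\<in>nbrs E x. C x y)"

definition vol :: "'v set set \<Rightarrow> ('v \<Rightarrow> 'v \<Rightarrow> real) \<Rightarrow> 'v set \<Rightarrow> real" where
  "vol E C A = (\<Sum>\<^sub>\<infinity>x\<in>A. vweight E C x)"

locale infinite_weighted_graph =
  fixes V :: "'v set" and E :: "'v set set" and C :: "'v \<Rightarrow> 'v \<Rightarrow> real"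
  assumes edges: "\<And>e. e \<in> E \<Longrightarrow> \<exists>x\<in>V. \<exists>y\<in>V. x \<noteq> y \<and> e = {x, y}"
    and infinite_V: "infinite V" and countable_V: "countable V"
    and infinite_E: "infinite E" and countable_E: "countable E"
    and connected: "\<And>x y. x \<in> V \<Longrightarrow> y \<in> V \<Longrightarrow> (x, y) \<in> (adj_rel E)\<^sup>*"
    and locally_finite: "\<And>x. x \<in> V \<Longrightarrow> finite (nbrs E x)"
    and weight_sym: "\<And>x y. {x, y} \<in> E \<Longrightarrow> C x y = C y x"
    and weight_pos: "\<And>x y. {x, y} \<in> E \<Longrightarrow> 0 < C x y"
    and weight_rat: "\<And>x y. {x, y} \<in> E \<Longrightarrow> C x y \<in> \<rat>"
    and finite_vol: "vweight E C summable_on V"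

definition mu :: "'v set \<Rightarrow> 'v set set \<Rightarrow> ('v \<Rightarrow> 'v \<Rightarrow> real) \<Rightarrow> 'v \<Rightarrow> real" where
  "mu V E C x = vweight E C x / vol E C V"

definition mu_measure :: "'v set \<Rightarrow> 'v set set \<Rightarrow> ('v \<Rightarrow> 'v \<Rightarrow> real) \<Rightarrow> 'v measure" where
  "mu_measure V E C = point_measure V (\<lambda>x. ennreal (mu V E C x))"

definition L2 :: "'a measure \<Rightarrow> ('a \<Rightarrow> real) set" where
  "L2 M = {f. f \<in> borel_measurable M \<and> integrable M (\<lambda>x. (f x)\<^sup>2)}"

definition L2_inner :: "'a measure \<Rightarrow> ('a \<Rightarrow> real) \<Rightarrow> ('a \<Rightarrow> real) \<Rightarrow> real" where
  "L2_inner M f g = (\<integral>x. f x * g x \<partial>M)"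

definition L2_norm :: "'a measure \<Rightarrow> ('a \<Rightarrow> real) \<Rightarrow> real" where
  "L2_norm M f = sqrt (L2_inner M f f)"

text \<open>The energy is a sum over unordered edges; the contribution of an edge does not depend on
  the order of its endpoints because \<open>C\<close> is symmetric.\<close>

definition edge_energy :: "('v \<Rightarrow> 'v \<Rightarrow> real) \<Rightarrow> ('v \<Rightarrow> real) \<Rightarrow> 'v set \<Rightarrow> real" where
  "edge_energy C f e = (THE r. \<exists>x y. e = {x, y} \<and> r = C x y * (f x - f y)\<^sup>2)"

text \<open>The sum always converges for \<open>f\<close> in \<open>L\<^sup>2(\<mu>)\<close>, see \<open>edge_energy_summable\<close> below.\<close>

definition energy :: "'v set set \<Rightarrow> ('v \<Rightarrow> 'v \<Rightarrow> real) \<Rightarrow> ('v \<Rightarrow> real) \<Rightarrow> real" where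
  "energy E C f = (\<Sum>\<^sub>\<infinity>e\<in>E. edge_energy C f e)"

definition trans_prob :: "'v set set \<Rightarrow> ('v \<Rightarrow> 'v \<Rightarrow> real) \<Rightarrow> 'v \<Rightarrow> 'v \<Rightarrow> real" where
  "trans_prob E C x y = (if y \<in> nbrs E x then C x y / vweight E C x else 0)"

definition trans_pmf :: "'v set set \<Rightarrow> ('v \<Rightarrow> 'v \<Rightarrow> real) \<Rightarrow> 'v \<Rightarrow> 'v pmf" where
  "trans_pmf E C x = embed_pmf (trans_prob E C x)"

text \<open>The kernel for time \<open>k\<close>, given the path \<open>\<omega>\<close> up to time \<open>k - 1\<close>, of the chain started at \<open>x\<close>;
  the law \<open>P\<^sub>x\<close> of the chain on path space is then given by the Ionescu-Tulcea construction,
  with \<open>X\<^sub>k\<close> the \<open>k\<close>-th coordinate map.\<close>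

definition chain_kernel ::
    "'v set set \<Rightarrow> ('v \<Rightarrow> 'v \<Rightarrow> real) \<Rightarrow> 'v \<Rightarrow> nat \<Rightarrow> (nat \<Rightarrow> 'v) \<Rightarrow> 'v measure" where
  "chain_kernel E C x k \<omega> =
     measure_pmf (if k = 0 then return_pmf x else trans_pmf E C (\<omega> (k - 1)))"

definition chain_law ::
    "'v set set \<Rightarrow> ('v \<Rightarrow> 'v \<Rightarrow> real) \<Rightarrow> 'v \<Rightarrow> (nat \<Rightarrow> 'v) measure" where
  "chain_law E C x =
     projective_family.lim UNIV
       (Ionescu_Tulcea.CI (chain_kernel E C x) (\<lambda>_. count_space UNIV))
       (\<lambda>_. count_space UNIV)"

text \<open>For \<open>n = 0\<close> the ball \<open>V\<^sub>-\<^sub>1\<close> should be empty, whereas truncated subtraction yields \<open>V\<^sub>0\<close>;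
  this single value is irrelevant, since only the limit superior of the sequence is used.\<close>

definition rho :: "'v set \<Rightarrow> 'v set set \<Rightarrow> ('v \<Rightarrow> 'v \<Rightarrow> real) \<Rightarrow> 'v \<Rightarrow> nat \<Rightarrow> real" where
  "rho V E C v0 n =
     (SUP x\<in>dsphere V E v0 n.
        measure (chain_law E C x)
          {\<omega> \<in> space (chain_law E C x). \<omega> 1 \<notin> dball V E v0 (n - 1)})"


lemma Ionescu_Tulcea_chain:
  "Ionescu_Tulcea (chain_kernel E C x) (\<lambda>_. count_space UNIV)"
proof (rule Ionescu_Tulcea.intro)
  fix i :: nat
  show "chain_kernel E C x i
      \<in> PiM {0..<i} (\<lambda>_. count_space UNIV) \<rightarrow>\<^sub>M subprob_algebra (count_space UNIV)"
  proof (cases i)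
    case 0
    then show ?thesis
      by (auto simp: chain_kernel_def[abs_def] space_subprob_algebra measure_pmf.subprob_space_axioms)
  next
    case (Suc j)
    have "(\<lambda>\<omega>. measure_pmf (trans_pmf E C (\<omega> j)))
        \<in> PiM {0..<i} (\<lambda>_. count_space UNIV) \<rightarrow>\<^sub>M subprob_algebra (count_space UNIV)"
    proof (rule measurable_compose[where N="count_space UNIV" and f="\<lambda>\<omega>. \<omega> j"
          and g="\<lambda>z. measure_pmf (trans_pmf E C z)"])
      show "(\<lambda>\<omega>. \<omega> j) \<in> PiM {0..<i} (\<lambda>_. count_space UNIV) \<rightarrow>\<^sub>M count_space UNIV"
        using Suc by (intro measurable_component_singleton) auto
      show "(\<lambda>z. measure_pmf (trans_pmf E C z)) \<in> count_space UNIV \<rightarrow>\<^sub>M subprob_algebra (count_space UNIV)"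
        by (simp add: space_subprob_algebra measure_pmf.subprob_space_axioms)
    qed
    then show ?thesis
      using Suc by (simp add: chain_kernel_def[abs_def])
  qed
next
  fix i :: nat and \<omega> :: "nat \<Rightarrow> 'a"
  show "prob_space (chain_kernel E C x i \<omega>)"
    unfolding chain_kernel_def by (rule measure_pmf.prob_space_axioms)
qed

lemma prob_chain_law_1:
  "measure (chain_law E C x) {\<omega> \<in> space (chain_law E C x). \<omega> 1 \<in> B}
     = measure_pmf.prob (trans_pmf E C x) B"
proof -
  let ?M = "\<lambda>_::nat. count_space (UNIV :: 'a set)"
  interpret IT: Ionescu_Tulcea "chain_kernel E C x" ?M
    by (rule Ionescu_Tulcea_chain)
  have law: "chain_law E C x = IT.PF.lim"
    by (simp add: chain_law_def)
  let ?J = "{0..<2::nat}"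
  let ?X = "{\<omega> \<in> space (PiM ?J ?M). \<omega> 1 \<in> B}"
  have c1: "(\<lambda>\<omega>. \<omega> 1) \<in> PiM ?J ?M \<rightarrow>\<^sub>M count_space UNIV"
    by (intro measurable_component_singleton) auto
  have X: "?X \<in> sets (PiM ?J ?M)"
    using measurable_sets[OF c1, of B] by (simp add: vimage_def Int_def conj_commute)
  have emb: "{\<omega> \<in> space (chain_law E C x). \<omega> 1 \<in> B} = IT.PF.emb UNIV ?J ?X"
    by (auto simp: law prod_emb_def space_PiM PiE_iff extensional_def restrict_def)
  have spu: "(\<lambda>_. undefined) \<in> space (PiM {0..<0} ?M)"
    by (simp add: space_PiM)
  have e0: "IT.C 0 (Suc 0) (\<lambda>_. undefined) = IT.eP 0 (\<lambda>_. undefined)"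
    using bind_return[OF IT.measurable_eP[of 0] spu] by simp
  have upd: "(\<lambda>_. undefined)(0 := z) \<in> space (PiM {0..<Suc 0} ?M)" for z
    by (auto simp: space_PiM PiE_iff extensional_def)
  have X': "?X \<in> sets (PiM {0..<Suc (Suc 0)} ?M)"
    using X by (simp add: numeral_2_eq_2)
  have "emeasure (chain_law E C x) {\<omega> \<in> space (chain_law E C x). \<omega> 1 \<in> B} = IT.CI ?J ?X"
    unfolding emb unfolding law by (rule IT.lim) (use X in auto)
  also have "\<dots> = IT.C 0 2 (\<lambda>_. undefined) ?X"
    using IT.emeasure_CI[OF subset_refl X] prod_emb_id[of ?X ?J ?M] sets.sets_into_space[OF X]
    by (simp add: space_PiM)
  also have "\<dots> = emeasure (IT.C 0 (Suc 0) (\<lambda>_. undefined) \<bind> IT.eP (Suc 0)) ?X"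
    by (simp only: numeral_2_eq_2 IT.C.simps(2)[of 0 "Suc 0"] add_0)
  also have "\<dots> = (\<integral>\<^sup>+\<omega>. IT.eP (Suc 0) \<omega> ?X \<partial>IT.eP 0 (\<lambda>_. undefined))"
    unfolding e0
    by (rule emeasure_bind[OF _ _ X'])
       (use IT.measurable_eP[of "Suc 0"] IT.sets_eP[OF spu] IT.space_eP[OF spu] upd in
         \<open>auto simp: measurable_cong_sets[OF IT.sets_eP[OF spu] refl]\<close>)
  also have "\<dots> = (\<integral>\<^sup>+z. IT.eP (Suc 0) ((\<lambda>_. undefined)(0 := z)) ?X
        \<partial>chain_kernel E C x 0 (\<lambda>_. undefined))"
    by (rule IT.nn_integral_eP[OF spu])
       (rule measurable_emeasure_kernel[OF IT.measurable_eP X'])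
  also have "\<dots> = IT.eP (Suc 0) ((\<lambda>_. undefined)(0 := x)) ?X"
    by (simp add: chain_kernel_def)
  also have "\<dots> = emeasure (trans_pmf E C x) B"
    by (subst IT.emeasure_eP[OF upd X'])
       (auto simp: chain_kernel_def space_PiM PiE_iff extensional_def vimage_def
             intro!: arg_cong2[where f=emeasure])
  finally show ?thesis
    by (simp add: measure_def)
qed

context infinite_weighted_graph
begin

lemma nbrs_subset: "nbrs E x \<subseteq> V"
proof
  fix y assume "y \<in> nbrs E x"
  then show "y \<in> V"
    using edges[of "{x, y}"] by (auto simp: nbrs_def doubleton_eq_iff)
qed

lemma nbrs_nonempty:
  assumes "x \<in> V" shows "nbrs E x \<noteq> {}"
proof -
  have "infinite (V - {x})" using infinite_V by simp
  then obtain y where "y \<in> V" "y \<noteq> x" by (metis Diff_iff finite.emptyI ex_in_conv insertI1)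
  with connected[OF assms this(1)] show ?thesis
    by (auto simp: adj_rel_def nbrs_def elim: converse_rtranclE)
qed

lemma vweight_pos: "x \<in> V \<Longrightarrow> 0 < vweight E C x"
  unfolding vweight_def
  by (intro sum_pos locally_finite nbrs_nonempty) (auto simp: nbrs_def intro: weight_pos)

lemma pmf_trans_pmf:
  assumes x: "x \<in> V"
  shows "pmf (trans_pmf E C x) y = trans_prob E C x y"
  unfolding trans_pmf_def
proof (rule pmf_embed_pmf)
  show nn: "0 \<le> trans_prob E C x y" for y
    using vweight_pos[OF x] weight_pos[of x y] by (auto simp: trans_prob_def nbrs_def less_imp_le)
  have "(\<integral>\<^sup>+ y. ennreal (trans_prob E C x y) \<partial>count_space UNIV)
      = (\<Sum>y\<in>nbrs E x. ennreal (trans_prob E C x y))"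
    by (intro nn_integral_count_space'[OF locally_finite[OF x]]) (auto simp: trans_prob_def)
  also have "\<dots> = ennreal (\<Sum>y\<in>nbrs E x. C x y / vweight E C x)"
    unfolding sum_ennreal[OF nn]
    by (auto intro!: arg_cong[where f=ennreal] sum.cong simp: trans_prob_def)
  also have "(\<Sum>y\<in>nbrs E x. C x y / vweight E C x) = 1"
    using vweight_pos[OF x] by (simp add: sum_divide_distrib[symmetric] vweight_def)
  finally show "(\<integral>\<^sup>+ y. ennreal (trans_prob E C x y) \<partial>count_space UNIV) = 1" by simp
qed

lemma edge_energy_eq:
  assumes "{x, y} \<in> E"
  shows "edge_energy C f {x, y} = C x y * (f x - f y)\<^sup>2"
  unfolding edge_energy_def
proof (rule the_equality)
  fix r assume "\<exists>x' y'. {x, y} = {x', y'} \<and> r = C x' y' * (f x' - f y')\<^sup>2"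
  then show "r = C x y * (f x - f y)\<^sup>2"
    using weight_sym[OF assms] by (auto simp: doubleton_eq_iff power2_commute)
qed blast

lemma vol_pos: "0 < vol E C V"
proof -
  obtain x where x: "x \<in> V" using infinite_V by (metis finite.emptyI ex_in_conv)
  have "(\<Sum>\<^sub>\<infinity>y\<in>{x}. vweight E C y) \<le> vol E C V"
    unfolding vol_def
    by (rule infsum_mono_neutral) (use x finite_vol vweight_pos in \<open>auto simp: less_imp_le\<close>)
  with vweight_pos[OF x] show ?thesis by simp
qed

lemma L2_summable:
  assumes "f \<in> L2 (mu_measure V E C)"
  shows "(\<lambda>x. vweight E C x * (f x)\<^sup>2) summable_on V"
proof -
  have "integrable (density (count_space V) (\<lambda>x. ennreal (mu V E C x))) (\<lambda>x. (f x)\<^sup>2)"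
    using assms by (simp add: L2_def mu_measure_def point_measure_def)
  then have "integrable (count_space V) (\<lambda>x. mu V E C x * (f x)\<^sup>2)"
    by (subst (asm) integrable_density)
       (use vol_pos vweight_pos in \<open>auto simp: mu_def AE_count_space less_imp_le\<close>)
  then have "(\<lambda>x. mu V E C x * (f x)\<^sup>2) summable_on V"
    unfolding abs_summable_on_def[symmetric] abs_summable_equivalent[symmetric]
    by (rule abs_summable_summable)
  then have "(\<lambda>x. vol E C V * (mu V E C x * (f x)\<^sup>2)) summable_on V"
    by (rule summable_on_cmult_right)
  then show ?thesis
    using vol_pos by (simp add: mu_def)
qed

lemma edge_energy_summable:
  assumes f: "f \<in> L2 (mu_measure V E C)"
  shows "edge_energy C f summable_on E"
proof (rule nonneg_bdd_above_summable_on)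
  let ?g = "\<lambda>x. vweight E C x * (f x)\<^sup>2"
  note sm = L2_summable[OF f]
  show nn: "0 \<le> edge_energy C f e" if "e \<in> E" for e
    using edges[OF that] that weight_pos by (auto simp: edge_energy_eq less_imp_le)
  define c where "c x e = C x (THE y. e = {x, y})" for x e
  have c: "c x {x, y} = C x y" for x y
    unfolding c_def by (rule arg_cong[where f="C x"], rule the_equality) (auto simp: doubleton_eq_iff)
  have bound: "edge_energy C f e \<le> (\<Sum>x\<in>e. 2 * c x e * (f x)\<^sup>2)" if "e \<in> E" for e
  proof -
    obtain x y where xy: "x \<noteq> y" "e = {x, y}" using edges[OF \<open>e \<in> E\<close>] by auto
    have "(f x - f y)\<^sup>2 \<le> 2 * (f x)\<^sup>2 + 2 * (f y)\<^sup>2"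
      using zero_le_power2[of "f x + f y"] by (simp add: power2_eq_square algebra_simps)
    then have "C x y * (f x - f y)\<^sup>2 \<le> C x y * (2 * (f x)\<^sup>2 + 2 * (f y)\<^sup>2)"
      using weight_pos[of x y] that xy by (intro mult_left_mono) (auto simp: less_imp_le)
    moreover have "c y {x, y} = C x y"
      using c[of y x] weight_sym[of x y] that xy by (simp add: insert_commute)
    ultimately show ?thesis
      using xy that by (simp add: edge_energy_eq c algebra_simps)
  qed
  show "bdd_above (sum (edge_energy C f) ` {F. F \<subseteq> E \<and> finite F})"
  proof (rule bdd_aboveI2)
    fix F assume "F \<in> {F. F \<subseteq> E \<and> finite F}"
    then have F: "F \<subseteq> E" "finite F" by auto
    have fin: "finite (\<Union>F)" and sub: "\<Union>F \<subseteq> V"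
      using F edges by (fastforce)+
    have star: "(\<Sum>e\<in>{e\<in>F. x \<in> e}. c x e) \<le> vweight E C x" if x: "x \<in> V" for x
    proof -
      have inj: "inj_on (\<lambda>y. {x, y}) (nbrs E x)" by (auto simp: inj_on_def doubleton_eq_iff)
      have img: "{e\<in>F. x \<in> e} \<subseteq> (\<lambda>y. {x, y}) ` nbrs E x"
      proof
        fix e assume "e \<in> {e\<in>F. x \<in> e}"
        then have e: "e \<in> E" "x \<in> e" using F by auto
        then obtain y where "e = {x, y}" using edges[OF e(1)] by (auto simp: insert_commute)
        with e show "e \<in> (\<lambda>y. {x, y}) ` nbrs E x" by (auto simp: nbrs_def)
      qed
      have "(\<Sum>e\<in>{e\<in>F. x \<in> e}. c x e) \<le> (\<Sum>e\<in>(\<lambda>y. {x, y}) ` nbrs E x. c x e)"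
        using img locally_finite[OF x] weight_pos
        by (intro sum_mono2) (auto simp: c nbrs_def less_imp_le)
      also have "\<dots> = vweight E C x"
        by (simp add: sum.reindex[OF inj] c vweight_def)
      finally show ?thesis .
    qed
    have "sum (edge_energy C f) F \<le> (\<Sum>e\<in>F. \<Sum>x\<in>e. 2 * c x e * (f x)\<^sup>2)"
      using F by (intro sum_mono bound) auto
    also have "\<dots> = (\<Sum>e\<in>F. \<Sum>x\<in>{x\<in>\<Union>F. x \<in> e}. 2 * c x e * (f x)\<^sup>2)"
      by (intro sum.cong refl) auto
    also have "\<dots> = (\<Sum>x\<in>\<Union>F. \<Sum>e\<in>{e\<in>F. x \<in> e}. 2 * c x e * (f x)\<^sup>2)"
      by (rule sum.swap_restrict) (use F fin in auto)
    also have "\<dots> = (\<Sum>x\<in>\<Union>F. 2 * ((\<Sum>e\<in>{e\<in>F. x \<in> e}. c x e) * (f x)\<^sup>2))"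
      by (simp add: sum_distrib_left sum_distrib_right mult.assoc)
    also have "\<dots> \<le> (\<Sum>x\<in>\<Union>F. 2 * ?g x)"
      using sub by (intro sum_mono mult_left_mono mult_right_mono star) auto
    also have "\<dots> = 2 * sum ?g (\<Union>F)" by (simp add: sum_distrib_left)
    also have "\<dots> \<le> 2 * infsum ?g V"
      using finite_sum_le_infsum[OF sm fin sub] vweight_pos by (simp add: less_imp_le)
    finally show "sum (edge_energy C f) F \<le> 2 * infsum ?g V" .
  qed
qed

end

end

theory Submission
  imports Defs
begin

text \<open>
  The weight \<open>w(x) = 2 ^ d(v\<^sub>0, x)\<close> is a Lyapunov function: if \<open>\<rho>\<^sub>n < 1/4\<close> then the chain goes
  down with probability at least \<open>3/4\<close>, so \<open>Pw \<le> (7/8) w\<close> on the sphere \<open>S\<^sub>n\<close>. The inequality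
  \<open>f(x)\<^sup>2 w(y)/w(x) + f(y)\<^sup>2 w(x)/w(y) \<ge> 2 f(x) f(y)\<close>, summed over the edges, gives
  \<open>\<Sum> m f\<^sup>2 (1 - Pw/w) \<le> \<E>(f, f)\<close>; hence the mass of \<open>f\<^sup>2\<close> outside a finite ball is controlled by
  the energy and by the mass inside the ball. Applied to \<open>f - f(v\<^sub>0)\<close>, the mass inside the ball is
  also controlled by the energy, by following paths from \<open>v\<^sub>0\<close>. Finally, subtracting a constant
  from a function of mean zero only increases its norm.
\<close>

context infinite_weighted_graph
begin

section \<open>Positivity of the weights and elementary properties of the energy\<close>

lemma weight_nonneg: "{x, y} \<in> E \<Longrightarrow> 0 \<le> C x y"
  using weight_pos[of x y] by simp

lemma vweight_nonneg: "x \<in> V \<Longrightarrow> 0 \<le> vweight E C x"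
  using vweight_pos[of x] by simp

lemma edge_in_V: "{x, y} \<in> E \<Longrightarrow> x \<in> V \<and> y \<in> V"
  using nbrs_subset[of x] nbrs_subset[of y] by (auto simp: nbrs_def insert_commute)

lemma edge_energy_nonneg: "e \<in> E \<Longrightarrow> 0 \<le> edge_energy C f e"
  using edges[of e] by (auto simp: edge_energy_eq weight_nonneg)

text \<open>Only differences of values enter the energy. This permits the normalisation to functions
  vanishing at the base vertex.\<close>

lemma energy_diff_const: "energy E C (\<lambda>x. f x - c) = energy E C f"
  by (simp add: energy_def edge_energy_def[abs_def])

lemma edge_energy_le_energy:
  assumes "f \<in> L2 (mu_measure V E C)" and "{x, y} \<in> E"
  shows "C x y * (f x - f y)\<^sup>2 \<le> energy E C f"
  using finite_sum_le_infsum[OF edge_energy_summable[OF assms(1)], of "{{x, y}}"] assms(2)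
  by (auto simp: energy_def edge_energy_eq edge_energy_nonneg)

subsection \<open>Integration against \<open>\<mu>\<close>\<close>

lemma measurable_mu_measure [measurable, simp]: "(f :: 'v \<Rightarrow> real) \<in> borel_measurable (mu_measure V E C)"
  by (simp add: mu_measure_def point_measure_def)

text \<open>The measure is a density with respect to counting measure, and a real family is summable
  exactly when it is absolutely summable; the positive factor 1 / m(V) does not affect this.\<close>

lemma integrable_mu_measure_iff:
  fixes f :: "'v \<Rightarrow> real"
  shows "integrable (mu_measure V E C) f \<longleftrightarrow> (\<lambda>x. vweight E C x * f x) summable_on V"
proof -
  have "integrable (mu_measure V E C) f \<longleftrightarrow> integrable (count_space V) (\<lambda>x. mu V E C x * f x)"
    unfolding mu_measure_def point_measure_def
    by (subst integrable_density)
       (use vol_pos vweight_nonneg in \<open>auto simp: mu_def AE_count_space\<close>)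
  also have "\<dots> \<longleftrightarrow> (\<lambda>x. mu V E C x * f x) summable_on V"
    unfolding abs_summable_on_def[symmetric] abs_summable_equivalent[symmetric]
    by (rule summable_on_iff_abs_summable_on_real[symmetric])
  also have "\<dots> \<longleftrightarrow> (\<lambda>x. inverse (vol E C V) * (vweight E C x * f x)) summable_on V"
    by (simp add: mu_def field_simps)
  also have "\<dots> \<longleftrightarrow> (\<lambda>x. vweight E C x * f x) summable_on V"
    by (rule summable_on_cmult_right') (use vol_pos in auto)
  finally show ?thesis .
qed

lemma integral_mu_measure:
  fixes f :: "'v \<Rightarrow> real"
  assumes "integrable (mu_measure V E C) f"
  shows "(\<integral>x. f x \<partial>mu_measure V E C) = (\<Sum>\<^sub>\<infinity>x\<in>V. vweight E C x * f x) / vol E C V"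
proof -
  have int: "integrable (count_space V) (\<lambda>x. mu V E C x * f x)"
    using assms unfolding mu_measure_def point_measure_def
    by (subst (asm) integrable_density)
       (use vol_pos vweight_nonneg in \<open>auto simp: mu_def AE_count_space\<close>)
  have "(\<integral>x. f x \<partial>mu_measure V E C) = (\<integral>x. mu V E C x * f x \<partial>count_space V)"
    unfolding mu_measure_def point_measure_def
    by (subst integral_density)
       (use vol_pos vweight_nonneg in \<open>auto simp: mu_def AE_count_space\<close>)
  also have "\<dots> = (\<Sum>\<^sub>\<infinity>x\<in>V. mu V E C x * f x)"
    unfolding infsetsum_def[symmetric]
    by (rule infsetsum_infsum) (use int in \<open>simp add: abs_summable_on_def\<close>)
  also have "\<dots> = (\<Sum>\<^sub>\<infinity>x\<in>V. inverse (vol E C V) * (vweight E C x * f x))"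
    by (simp add: mu_def field_simps)
  also have "\<dots> = (\<Sum>\<^sub>\<infinity>x\<in>V. vweight E C x * f x) / vol E C V"
    by (subst infsum_cmult_right') (simp add: field_simps)
  finally show ?thesis .
qed

lemma integrable_mu_const: "integrable (mu_measure V E C) (\<lambda>_. c :: real)"
  unfolding integrable_mu_measure_iff by (intro summable_on_cmult_left finite_vol)

text \<open>The measure is finite, so constants are integrable and \<open>1 + (f x)\<^sup>2\<close>
  dominates \<open>\<bar>f x\<bar>\<close>.\<close>

lemma L2_integrable:
  assumes "f \<in> L2 (mu_measure V E C)"
  shows "integrable (mu_measure V E C) f"
proof (rule Bochner_Integration.integrable_bound)
  show "integrable (mu_measure V E C) (\<lambda>x. 1 + (f x)\<^sup>2)"
    using assms integrable_mu_const by (auto simp: L2_def)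
  have "\<bar>t\<bar> \<le> 1 + t\<^sup>2" for t :: real
    using zero_le_power2[of "\<bar>t\<bar> - 1"] zero_le_power2[of t] by (simp add: power2_diff)
  then show "AE x in mu_measure V E C. norm (f x) \<le> norm (1 + (f x)\<^sup>2)"
    by (simp add: add_nonneg_nonneg)
qed simp

lemma L2_diff_const:
  assumes "f \<in> L2 (mu_measure V E C)"
  shows "(\<lambda>x. f x - c) \<in> L2 (mu_measure V E C)"
  using assms L2_integrable[OF assms] integrable_mu_const by (simp add: L2_def power2_diff)

text \<open>Among all constants, the mean is the best approximation in L2. The right-hand side is
  the squared norm of \<open>f - c\<close>, written as a weighted sum.\<close>

lemma L2_norm_le_diff_const:
  assumes f: "f \<in> L2 (mu_measure V E C)" and mean: "L2_inner (mu_measure V E C) f (\<lambda>_. 1) = 0"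
  shows "(L2_norm (mu_measure V E C) f)\<^sup>2
    \<le> (\<Sum>\<^sub>\<infinity>x\<in>V. vweight E C x * (f x - c)\<^sup>2) / vol E C V"
proof -
  let ?M = "mu_measure V E C"
  have sq: "integrable ?M (\<lambda>x. (f x)\<^sup>2)" and i: "integrable ?M f"
    using f L2_integrable[OF f] by (auto simp: L2_def)
  have "integrable ?M (\<lambda>x. (f x - c)\<^sup>2)"
    using L2_diff_const[OF f] by (simp add: L2_def)
  then have "(\<Sum>\<^sub>\<infinity>x\<in>V. vweight E C x * (f x - c)\<^sup>2) / vol E C V = (\<integral>x. (f x - c)\<^sup>2 \<partial>?M)"
    by (rule integral_mu_measure[symmetric])
  also have "\<dots> = (\<integral>x. (f x)\<^sup>2 - (2 * c) * f x + c\<^sup>2 \<partial>?M)"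
    by (simp add: power2_diff algebra_simps)
  also have "\<dots> = (\<integral>x. (f x)\<^sup>2 \<partial>?M) - 2 * c * (\<integral>x. f x \<partial>?M) + (\<integral>x. c\<^sup>2 \<partial>?M)"
    using sq i integrable_mu_const[of "c\<^sup>2"] by simp
  \<comment> \<open>The cross term vanishes because \<open>f\<close> has mean zero, and the integral
    of \<open>c\<^sup>2\<close> is nonnegative.\<close>
  also have "\<dots> \<ge> (\<integral>x. (f x)\<^sup>2 \<partial>?M)"
    using mean by (simp add: L2_inner_def del: lebesgue_integral_const)
  also have "(\<integral>x. (f x)\<^sup>2 \<partial>?M) = (L2_norm ?M f)\<^sup>2"
    by (simp add: L2_norm_def L2_inner_def power2_eq_square)
  finally show ?thesis .
qed

subsection \<open>The Hardy inequality\<close>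

lemma bij_betw_swap_directed_edges:
  "bij_betw prod.swap (Sigma V (nbrs E)) (Sigma V (nbrs E))"
  by (rule bij_betwI[where g = prod.swap])
     (auto simp: nbrs_def insert_commute dest: edge_in_V)

text \<open>Each undirected edge has at most two orientations, so twice the energy bounds all finite
  partial sums over directed edges. Summability and the bound on the infinite sum both
  follow.\<close>

lemma directed_energy:
  assumes f: "f \<in> L2 (mu_measure V E C)"
  defines "h \<equiv> \<lambda>(x, y). C x y * (f x - f y)\<^sup>2"
  shows "h summable_on Sigma V (nbrs E)" and "infsum h (Sigma V (nbrs E)) \<le> 2 * energy E C f"
proof -
  have bound: "sum h F \<le> 2 * energy E C f" if F: "finite F" "F \<subseteq> Sigma V (nbrs E)" for F
  proof -
    let ?g = "\<lambda>(x, y). {x, y}"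
    have gF: "?g ` F \<subseteq> E" using F by (auto simp: nbrs_def)
    \<comment> \<open>Directed edges are grouped by their underlying undirected edge.\<close>
    have "sum h F = (\<Sum>e\<in>?g ` F. sum h {p \<in> F. ?g p = e})"
      by (rule sum.image_gen[OF F(1)])
    also have "\<dots> \<le> (\<Sum>e\<in>?g ` F. 2 * edge_energy C f e)"
    proof (rule sum_mono)
      fix e assume "e \<in> ?g ` F"
      then obtain x y where e: "e = {x, y}" "e \<in> E" using gF by auto
      have "sum h {p \<in> F. ?g p = e} = (\<Sum>p\<in>{p \<in> F. ?g p = e}. edge_energy C f e)"
        using e by (intro sum.cong) (auto simp: h_def edge_energy_eq[symmetric])
      also have "\<dots> = real (card {p \<in> F. ?g p = e}) * edge_energy C f e" by simp
      also have "\<dots> \<le> 2 * edge_energy C f e"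
      proof (rule mult_right_mono)
        have "{p \<in> F. ?g p = e} \<subseteq> {(x, y), (y, x)}"
        proof
          fix p assume "p \<in> {p \<in> F. ?g p = e}"
          then have "{fst p, snd p} = {x, y}" using e(1) by (simp add: case_prod_unfold)
          then show "p \<in> {(x, y), (y, x)}"
            unfolding doubleton_eq_iff by (cases p) auto
        qed
        then have "card {p \<in> F. ?g p = e} \<le> card {(x, y), (y, x)}"
          by (intro card_mono) auto
        also have "\<dots> \<le> 2"
          using card_length[of "[(x, y), (y, x)]"] by simp
        finally show "real (card {p \<in> F. ?g p = e}) \<le> 2" by simp
      qed (use e edge_energy_nonneg in auto)
      finally show "sum h {p \<in> F. ?g p = e} \<le> 2 * edge_energy C f e" .
    qed
    also have "\<dots> = 2 * sum (edge_energy C f) (?g ` F)" by (simp add: sum_distrib_left)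
    also have "\<dots> \<le> 2 * energy E C f"
      unfolding energy_def
      using finite_sum_le_infsum[OF edge_energy_summable[OF f], of "?g ` F"] F gF edge_energy_nonneg
      by auto
    finally show ?thesis .
  qed
  show sm: "h summable_on Sigma V (nbrs E)"
  proof (rule nonneg_bdd_above_summable_on)
    show "bdd_above (sum h ` {F. F \<subseteq> Sigma V (nbrs E) \<and> finite F})"
      using bound by (intro bdd_aboveI2) auto
  qed (auto simp: h_def nbrs_def weight_nonneg)
  show "infsum h (Sigma V (nbrs E)) \<le> 2 * energy E C f"
    by (rule infsum_le_finite_sums[OF sm bound])
qed

text \<open>Summing over the neighbours of \<open>x\<close> first leaves
  \<open>vweight E C x * (f x)\<^sup>2\<close>, which is summable for \<open>f\<close> in L2. This
  is the dominating family for the Hardy inequality.\<close>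

lemma summable_directed_edges:
  assumes f: "f \<in> L2 (mu_measure V E C)"
  shows "(\<lambda>(x, y). C x y * (f x)\<^sup>2) summable_on Sigma V (nbrs E)"
proof (rule summable_on_SigmaI[where g = "\<lambda>x. vweight E C x * (f x)\<^sup>2"])
  show "((\<lambda>y. case (x, y) of (x, y) \<Rightarrow> C x y * (f x)\<^sup>2) has_sum vweight E C x * (f x)\<^sup>2) (nbrs E x)"
    if "x \<in> V" for x
    by (intro has_sum_finiteI) (use that locally_finite in \<open>auto simp: vweight_def sum_distrib_right\<close>)
  show "(\<lambda>x. vweight E C x * (f x)\<^sup>2) summable_on V"
    by (rule L2_summable[OF f])
qed (auto simp: nbrs_def weight_nonneg)

text \<open>The right side minus the left side is the nonnegative quantity
  \<open>(a * t - b * s)\<^sup>2 / (s * t)\<close>.\<close>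

lemma hardy_pointwise:
  fixes a b s t :: real
  assumes "s > 0" "t > 0"
  shows "a\<^sup>2 * (1 - t / s) + b\<^sup>2 * (1 - s / t) \<le> (a - b)\<^sup>2"
proof -
  have "0 \<le> (a * t - b * s)\<^sup>2 / (s * t)" using assms by simp
  also have "\<dots> = a\<^sup>2 * (t / s) + b\<^sup>2 * (s / t) - 2 * a * b"
    using assms by (simp add: field_simps power2_eq_square)
  finally show ?thesis by (simp add: algebra_simps power2_eq_square)
qed

text \<open>The function \<open>k\<close> is m f^2 (1 - Pw/w), with P the transition operator. The
  bound \<open>B\<close> on the ratios of \<open>w\<close> along edges gives absolute summability
  over directed edges, so that the sum may be rearranged and symmetrised.\<close>

lemma hardy_inequality:
  fixes w :: "'v \<Rightarrow> real"
  assumes f: "f \<in> L2 (mu_measure V E C)"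
    and w_pos: "\<And>x. x \<in> V \<Longrightarrow> w x > 0"
    and w_bound: "\<And>x y. {x, y} \<in> E \<Longrightarrow> w y \<le> B * w x"
  defines "k \<equiv> \<lambda>x. (f x)\<^sup>2 * (vweight E C x - (\<Sum>y\<in>nbrs E x. C x y * (w y / w x)))"
  shows "k summable_on V" and "infsum k V \<le> energy E C f"
proof -
  let ?D = "Sigma V (nbrs E)"
  \<comment> \<open>The share of the directed edge from \<open>x\<close> to \<open>y\<close>; summed
    over \<open>y\<close> it gives \<open>k x\<close>.\<close>
  define h where "h = (\<lambda>x y. C x y * (f x)\<^sup>2 * (1 - w y / w x))"
  have hs: "(\<lambda>(x, y). h x y) summable_on ?D"
  proof -
    have "(\<lambda>p. (1 + B) * (\<lambda>(x, y). C x y * (f x)\<^sup>2) p) summable_on ?D"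
      by (intro summable_on_cmult_right summable_directed_edges f)
    then have "(\<lambda>p. norm ((\<lambda>(x, y). h x y) p)) summable_on ?D"
    proof (rule summable_on_comparison_test)
      fix p assume "p \<in> ?D"
      then obtain x y where p: "p = (x, y)" "{x, y} \<in> E" by (auto simp: nbrs_def)
      then have pos: "w x > 0" "w y > 0" using w_pos edge_in_V[of x y] by auto
      then have r: "0 < w y / w x" "w y / w x \<le> B" using w_bound[OF p(2)] by (auto simp: field_simps)
      have "\<bar>h x y\<bar> = C x y * (f x)\<^sup>2 * \<bar>1 - w y / w x\<bar>"
        using weight_nonneg[OF p(2)] by (simp add: h_def abs_mult)
      also have "\<dots> \<le> C x y * (f x)\<^sup>2 * (1 + B)"
        using r weight_nonneg[OF p(2)] by (intro mult_left_mono) auto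
      finally show "norm ((\<lambda>(x, y). h x y) p) \<le> (1 + B) * (\<lambda>(x, y). C x y * (f x)\<^sup>2) p"
        by (simp add: p mult.commute)
    qed auto
    then show ?thesis
      by (rule abs_summable_summable)
  qed
  have inner: "infsum (h x) (nbrs E x) = k x" if "x \<in> V" for x
    using locally_finite[OF that]
    by (simp add: h_def k_def vweight_def sum_distrib_left sum_subtractf[symmetric] algebra_simps)
  show "k summable_on V"
    using summable_on_Sigma_banach[OF hs] inner by (simp cong: summable_on_cong)
  have k: "infsum k V = infsum (\<lambda>(x, y). h x y) ?D"
    using infsum_Sigma'_banach[OF hs] inner by (simp cong: infsum_cong)
  have sw: "infsum (\<lambda>p. (\<lambda>(x, y). h x y) (prod.swap p)) ?D = infsum (\<lambda>(x, y). h x y) ?D"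
    by (rule infsum_reindex_bij_betw[OF bij_betw_swap_directed_edges])
  have hs': "(\<lambda>p. (\<lambda>(x, y). h x y) (prod.swap p)) summable_on ?D"
    using hs summable_on_reindex_bij_betw[OF bij_betw_swap_directed_edges] by blast
  \<comment> \<open>Adding the sum over reversed edges pairs \<open>h x y\<close> with
    \<open>h y x\<close>, to which the pointwise inequality applies. The factor 2 cancels against
    the one in \<open>directed_energy\<close>.\<close>
  have "2 * infsum k V
      = infsum (\<lambda>p. (\<lambda>(x, y). h x y) p + (\<lambda>(x, y). h x y) (prod.swap p)) ?D"
    unfolding infsum_add[OF hs hs'] sw k by simp
  also have "\<dots> \<le> infsum (\<lambda>(x, y). C x y * (f x - f y)\<^sup>2) ?D"
  proof (rule infsum_mono)
    show "(\<lambda>p. (\<lambda>(x, y). h x y) p + (\<lambda>(x, y). h x y) (prod.swap p)) summable_on ?D"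
      by (rule summable_on_add[OF hs hs'])
    show "(\<lambda>(x, y). C x y * (f x - f y)\<^sup>2) summable_on ?D"
      by (rule directed_energy[OF f])
    fix p assume "p \<in> ?D"
    then obtain x y where p: "p = (x, y)" "{x, y} \<in> E" by (auto simp: nbrs_def)
    then have pos: "w x > 0" "w y > 0" using w_pos edge_in_V[of x y] by auto
    have "h x y + h y x = C x y * ((f x)\<^sup>2 * (1 - w y / w x) + (f y)\<^sup>2 * (1 - w x / w y))"
      using weight_sym[OF p(2)] by (simp add: h_def distrib_left mult.assoc)
    also have "\<dots> \<le> C x y * (f x - f y)\<^sup>2"
      by (intro mult_left_mono hardy_pointwise pos weight_nonneg p)
    finally show "(\<lambda>(x, y). h x y) p + (\<lambda>(x, y). h x y) (prod.swap p)
        \<le> (\<lambda>(x, y). C x y * (f x - f y)\<^sup>2) p"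
      by (simp add: p)
  qed
  also have "\<dots> \<le> 2 * energy E C f" by (rule directed_energy[OF f])
  finally show "infsum k V \<le> energy E C f" by simp
qed

subsection \<open>Balls around the base vertex\<close>

text \<open>Connectedness makes the set of path lengths nonempty, so its least element is
  attained.\<close>

lemma relpow_graph_dist:
  assumes "v \<in> V" "x \<in> V"
  shows "(v, x) \<in> adj_rel E ^^ graph_dist E v x"
  unfolding graph_dist_def
  by (rule LeastI_ex, rule rtrancl_imp_relpow[OF connected[OF assms]])

lemma graph_dist_edge:
  assumes "v \<in> V" "{x, y} \<in> E"
  shows "graph_dist E v y \<le> Suc (graph_dist E v x)"
proof -
  have "(v, y) \<in> adj_rel E ^^ Suc (graph_dist E v x)"
    using relpow_graph_dist[OF assms(1), of x] assms edge_in_V[of x y] by (auto simp: adj_rel_def)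
  then show ?thesis
    unfolding graph_dist_def[of E v y] by (rule Least_le)
qed

text \<open>The inclusion in \<open>V\<close> is part of the induction because local finiteness is
  available only at vertices of \<open>V\<close>.\<close>

lemma finite_relpow_image:
  assumes "v \<in> V"
  shows "finite {x. (v, x) \<in> adj_rel E ^^ n} \<and> {x. (v, x) \<in> adj_rel E ^^ n} \<subseteq> V"
proof (induction n)
  case (Suc n)
  have "{x. (v, x) \<in> adj_rel E ^^ Suc n} = (\<Union>x\<in>{x. (v, x) \<in> adj_rel E ^^ n}. nbrs E x)"
    by (auto simp: adj_rel_def nbrs_def)
  moreover have "finite (nbrs E x)" if "(v, x) \<in> adj_rel E ^^ n" for x
    using that Suc locally_finite by auto
  ultimately show ?case
    using Suc nbrs_subset by auto
qed (use assms in auto)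

lemma finite_dball:
  assumes "v \<in> V"
  shows "finite (dball V E v n)"
proof (rule finite_subset)
  show "dball V E v n \<subseteq> (\<Union>k\<le>n. {x. (v, x) \<in> adj_rel E ^^ k})"
    using relpow_graph_dist[OF assms] by (auto simp: dball_def)
qed (use finite_relpow_image[OF assms] in auto)

text \<open>Induction along a path from \<open>v\<close> to \<open>x\<close>; the constant depends
  on the path but not on \<open>f\<close>.\<close>

lemma vertex_difference_le_energy:
  assumes "v \<in> V" "x \<in> V"
  shows "\<exists>k\<ge>0. \<forall>f\<in>L2 (mu_measure V E C). (f x - f v)\<^sup>2 \<le> k * energy E C f"
  using connected[OF assms]
proof (induction rule: rtrancl_induct)
  case base
  show ?case by (intro exI[of _ 0]) auto
next
  case (step x y)
  then have e: "{x, y} \<in> E" by (simp add: adj_rel_def)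
  obtain k where k: "k \<ge> 0" "\<forall>f\<in>L2 (mu_measure V E C). (f x - f v)\<^sup>2 \<le> k * energy E C f"
    using step.IH by blast
  have "(f y - f v)\<^sup>2 \<le> (2 / C x y + 2 * k) * energy E C f"
    if f: "f \<in> L2 (mu_measure V E C)" for f
  proof -
    \<comment> \<open>The two sides differ by the square of \<open>f x - f y + (f x - f v)\<close>.
      The first term on the right costs one edge of the energy, the second is the induction
      hypothesis.\<close>
    have "(f y - f v)\<^sup>2 \<le> 2 * (f x - f y)\<^sup>2 + 2 * (f x - f v)\<^sup>2"
      using zero_le_power2[of "f x - f y + (f x - f v)"]
      by (simp add: power2_eq_square algebra_simps)
    moreover have "(f x - f y)\<^sup>2 \<le> energy E C f / C x y"
      using edge_energy_le_energy[OF f e] weight_pos[OF e] by (simp add: field_simps)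
    moreover have "(f x - f v)\<^sup>2 \<le> k * energy E C f" using k f by blast
    ultimately show ?thesis by (simp add: algebra_simps)
  qed
  then show ?case
    using k weight_pos[OF e] by (intro exI[of _ "2 / C x y + 2 * k"]) auto
qed

text \<open>The ball is finite, so the constants of its vertices can be added up with weights; they
  are chosen before \<open>f\<close>, which makes the result uniform in \<open>f\<close>.\<close>

lemma ball_mass_le_energy:
  assumes "v \<in> V"
  shows "\<exists>k\<ge>0. \<forall>f\<in>L2 (mu_measure V E C).
    (\<Sum>x\<in>dball V E v n. vweight E C x * (f x - f v)\<^sup>2) \<le> k * energy E C f"
proof -
  have "\<forall>x\<in>V. \<exists>k\<ge>0. \<forall>f\<in>L2 (mu_measure V E C). (f x - f v)\<^sup>2 \<le> k * energy E C f"
    using vertex_difference_le_energy[OF assms] by blast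
  from bchoice[OF this] obtain k where k: "\<And>x. x \<in> V \<Longrightarrow> k x \<ge> 0"
    "\<And>x f. x \<in> V \<Longrightarrow> f \<in> L2 (mu_measure V E C) \<Longrightarrow> (f x - f v)\<^sup>2 \<le> k x * energy E C f"
    by blast
  have sub: "dball V E v n \<subseteq> V" by (auto simp: dball_def)
  have "(\<Sum>x\<in>dball V E v n. vweight E C x * (f x - f v)\<^sup>2)
      \<le> (\<Sum>x\<in>dball V E v n. vweight E C x * k x) * energy E C f"
    if "f \<in> L2 (mu_measure V E C)" for f
    unfolding sum_distrib_right mult.assoc
    using that sub by (intro sum_mono mult_left_mono k vweight_nonneg) auto
  moreover have "(\<Sum>x\<in>dball V E v n. vweight E C x * k x) \<ge> 0"
    using sub by (intro sum_nonneg mult_nonneg_nonneg k vweight_nonneg) auto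
  ultimately show ?thesis by blast
qed

subsection \<open>The drift condition\<close>

text \<open>By \<open>prob_chain_law_1\<close> the path-space probability in \<open>rho\<close> is a
  one-step transition probability, that is, a ratio of edge weights to
  \<open>vweight E C x\<close>.\<close>

lemma outward_weight_le_rho:
  assumes x: "x \<in> dsphere V E v n"
  shows "(\<Sum>y\<in>nbrs E x - dball V E v (n - 1). C x y) \<le> rho V E C v n * vweight E C x"
proof -
  have xV: "x \<in> V" using x by (simp add: dsphere_def)
  let ?O = "- dball V E v (n - 1)"
  have rho: "rho V E C v n = (SUP x\<in>dsphere V E v n. measure_pmf.prob (trans_pmf E C x) ?O)"
    unfolding rho_def prob_chain_law_1[symmetric] by simp
  have "(\<Sum>y\<in>nbrs E x - dball V E v (n - 1). C x y) / vweight E C x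
      = (\<Sum>y\<in>nbrs E x - dball V E v (n - 1). pmf (trans_pmf E C x) y)"
    by (simp add: sum_divide_distrib pmf_trans_pmf[OF xV] trans_prob_def)
  also have "\<dots> = measure_pmf.prob (trans_pmf E C x) (nbrs E x - dball V E v (n - 1))"
    using locally_finite[OF xV] by (simp add: measure_measure_pmf_finite)
  also have "\<dots> \<le> measure_pmf.prob (trans_pmf E C x) ?O"
    by (intro measure_pmf.finite_measure_mono) auto
  \<comment> \<open>A real supremum bounds its members only if the family is bounded above; here 1
    is a bound.\<close>
  also have "\<dots> \<le> rho V E C v n"
    unfolding rho by (intro cSUP_upper x bdd_aboveI2[where M = 1] measure_pmf.prob_le_1)
  finally show ?thesis
    using vweight_pos[OF xV] by (simp add: field_simps)
qed

text \<open>If a fraction q of the weight at \<open>x\<close> leads out of the smaller ball, the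
  mean ratio is at most (1 - q)/2 + 2q = 1/2 + 3q/2, and q \<le> 1/4 gives 7/8.\<close>

lemma drift_condition:
  assumes v: "v \<in> V" and x: "x \<in> V" "graph_dist E v x = n" "n > 0" and rho: "rho V E C v n \<le> 1 / 4"
  shows "(\<Sum>y\<in>nbrs E x. C x y * (2 ^ graph_dist E v y / 2 ^ graph_dist E v x)) \<le> 7 / 8 * vweight E C x"
proof -
  let ?D = "nbrs E x \<inter> dball V E v (n - 1)" and ?U = "nbrs E x - dball V E v (n - 1)"
  let ?r = "\<lambda>y. 2 ^ graph_dist E v y / 2 ^ graph_dist E v x :: real"
  note fin = locally_finite[OF x(1)]
  have split: "(\<Sum>y\<in>nbrs E x. g y) = (\<Sum>y\<in>?D. g y) + (\<Sum>y\<in>?U. g y)" for g :: "'v \<Rightarrow> real"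
    by (rule sum.Int_Diff[OF fin])
  have down: "?r y \<le> 1 / 2" if "y \<in> ?D" for y
  proof -
    \<comment> \<open>Since \<open>n > 0\<close>, the subtraction in \<open>n - 1\<close> is not
      truncated and \<open>y\<close> is strictly closer to \<open>v\<close> than
      \<open>x\<close>.\<close>
    have "(2::real) ^ Suc (graph_dist E v y) \<le> 2 ^ n"
      using that \<open>n > 0\<close> by (intro power_increasing) (auto simp: dball_def)
    then show ?thesis using x by (simp add: field_simps)
  qed
  have up: "?r y \<le> 2" if "y \<in> ?U" for y
  proof -
    have "(2::real) ^ graph_dist E v y \<le> 2 ^ Suc n"
      using that graph_dist_edge[OF v, of x y] x by (intro power_increasing) (auto simp: nbrs_def)
    then show ?thesis using x by (simp add: field_simps)
  qed
  have "(\<Sum>y\<in>nbrs E x. C x y * ?r y) \<le> (\<Sum>y\<in>?D. C x y * (1 / 2)) + (\<Sum>y\<in>?U. C x y * 2)"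
    unfolding split
    by (intro add_mono sum_mono mult_left_mono down up) (auto simp: nbrs_def weight_nonneg)
  also have "\<dots> = vweight E C x / 2 + 3 / 2 * (\<Sum>y\<in>?U. C x y)"
    using split[of "C x"] by (simp add: vweight_def sum_distrib_right[symmetric] sum_divide_distrib[symmetric]
        add_divide_distrib)
  also have "(\<Sum>y\<in>?U. C x y) \<le> vweight E C x / 4"
  proof -
    have "(\<Sum>y\<in>?U. C x y) \<le> rho V E C v n * vweight E C x"
      using x by (intro outward_weight_le_rho) (simp add: dsphere_def)
    also have "\<dots> \<le> 1 / 4 * vweight E C x"
      using rho vweight_nonneg[OF x(1)] by (intro mult_right_mono)
    finally show ?thesis by simp
  qed
  finally show ?thesis by simp
qed

text \<open>A crude bound for vertices inside the ball, where no control of \<open>rho\<close> is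
  available.\<close>

lemma drift_le_double:
  assumes "v \<in> V" "x \<in> V"
  shows "(\<Sum>y\<in>nbrs E x. C x y * (2 ^ graph_dist E v y / 2 ^ graph_dist E v x)) \<le> 2 * vweight E C x"
proof -
  have "2 ^ graph_dist E v y / 2 ^ graph_dist E v x \<le> (2::real)" if "{x, y} \<in> E" for y
    using power_increasing[OF graph_dist_edge[OF assms(1) that], of "2::real"]
    by (simp add: field_simps)
  then have "(\<Sum>y\<in>nbrs E x. C x y * (2 ^ graph_dist E v y / 2 ^ graph_dist E v x))
      \<le> (\<Sum>y\<in>nbrs E x. C x y * 2)"
    by (intro sum_mono mult_left_mono) (auto simp: nbrs_def weight_nonneg)
  also have "\<dots> = 2 * vweight E C x" by (simp add: vweight_def sum_distrib_right[symmetric])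
  finally show ?thesis .
qed

section \<open>From the drift condition to the Poincare inequality\<close>

lemma mass_le_energy_plus_ball_mass:
  assumes v: "v \<in> V" and rho: "\<And>n. n > N \<Longrightarrow> rho V E C v n \<le> 1 / 4"
    and f: "f \<in> L2 (mu_measure V E C)"
  shows "(\<Sum>\<^sub>\<infinity>x\<in>V. vweight E C x * (f x)\<^sup>2)
    \<le> 8 * energy E C f + 9 * (\<Sum>x\<in>dball V E v N. vweight E C x * (f x)\<^sup>2)"
proof -
  let ?w = "\<lambda>x. 2 ^ graph_dist E v x :: real" and ?B = "dball V E v N"
  let ?P = "\<lambda>x. \<Sum>y\<in>nbrs E x. C x y * (?w y / ?w x)"
  let ?m = "\<lambda>x. vweight E C x * (f x)\<^sup>2"
  let ?k = "\<lambda>x. (f x)\<^sup>2 * (vweight E C x - ?P x)"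
  \<comment> \<open>Extending the ball mass by zero lets the comparison be made termwise over all of
    \<open>V\<close>.\<close>
  let ?b = "\<lambda>x. if x \<in> ?B then ?m x else 0"
  have w_edge: "?w y \<le> 2 * ?w x" if "{x, y} \<in> E" for x y
    using power_increasing[OF graph_dist_edge[OF v that], of "2::real"] by simp
  have hardy: "?k summable_on V" "infsum ?k V \<le> energy E C f"
    using hardy_inequality[OF f, of ?w 2] w_edge by auto
  have sub: "?B \<subseteq> V" by (auto simp: dball_def)
  have bs: "(?b has_sum (\<Sum>x\<in>?B. ?m x)) V"
  proof -
    have "(?m has_sum (\<Sum>x\<in>?B. ?m x)) ?B" by (rule has_sum_finite[OF finite_dball[OF v]])
    also have "(?m has_sum (\<Sum>x\<in>?B. ?m x)) ?B \<longleftrightarrow> (?b has_sum (\<Sum>x\<in>?B. ?m x)) V"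
      using sub by (intro has_sum_cong_neutral) auto
    finally show ?thesis .
  qed
  have "infsum ?m V \<le> infsum (\<lambda>x. 8 * ?k x + 9 * ?b x) V"
  proof (rule infsum_mono)
    show "?m summable_on V" by (rule L2_summable[OF f])
    show "(\<lambda>x. 8 * ?k x + 9 * ?b x) summable_on V"
      using hardy(1) has_sum_imp_summable[OF bs] by (intro summable_on_add summable_on_cmult_right)
    fix x assume x: "x \<in> V"
    \<comment> \<open>Outside the ball \<open>vweight E C x - ?P x\<close> is at least an eighth of
      the weight, whence the 8. Inside it may be as low as minus the weight, so 8 + 1 = 9 copies of
      the weight compensate.\<close>
    have "vweight E C x \<le> 8 * (vweight E C x - ?P x) + 9 * (if x \<in> ?B then vweight E C x else 0)"
    proof (cases "x \<in> ?B")
      case True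
      then show ?thesis using drift_le_double[OF v x] by simp
    next
      case False
      then have "graph_dist E v x > N" using x by (simp add: dball_def)
      then show ?thesis
        using drift_condition[OF v x refl _ rho] False by simp
    qed
    from mult_right_mono[OF this zero_le_power2[of "f x"]]
    show "?m x \<le> 8 * ?k x + 9 * ?b x" by (simp add: algebra_simps split: if_splits)
  qed
  also have "\<dots> = 8 * infsum ?k V + 9 * (\<Sum>x\<in>?B. ?m x)"
    using hardy(1) has_sum_imp_summable[OF bs] infsumI[OF bs]
    by (subst infsum_add) (auto intro: summable_on_cmult_right simp: infsum_cmult_right')
  finally show ?thesis using hardy(2) by simp
qed

text \<open>The mass bound is applied to \<open>f - f v\<close>, which has the same energy as
  \<open>f\<close> and whose ball mass is at most \<open>k\<close> times that energy. Division by
  the total volume passes to the probability measure.\<close>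

lemma poincare_inequality:
  assumes v: "v \<in> V" and rho: "\<And>n. n > N \<Longrightarrow> rho V E C v n \<le> 1 / 4"
  shows "\<exists>K>0. \<forall>f\<in>L2 (mu_measure V E C). L2_inner (mu_measure V E C) f (\<lambda>_. 1) = 0 \<longrightarrow>
    (L2_norm (mu_measure V E C) f)\<^sup>2 \<le> K * energy E C f"
proof -
  obtain k where k: "k \<ge> 0" "\<And>f. f \<in> L2 (mu_measure V E C) \<Longrightarrow>
      (\<Sum>x\<in>dball V E v N. vweight E C x * (f x - f v)\<^sup>2) \<le> k * energy E C f"
    using ball_mass_le_energy[OF v, of N] by blast
  have "(L2_norm (mu_measure V E C) f)\<^sup>2 \<le> (8 + 9 * k) / vol E C V * energy E C f"
    if f: "f \<in> L2 (mu_measure V E C)" and mean: "L2_inner (mu_measure V E C) f (\<lambda>_. 1) = 0" for f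
  proof -
    have "(\<Sum>\<^sub>\<infinity>x\<in>V. vweight E C x * (f x - f v)\<^sup>2) \<le> (8 + 9 * k) * energy E C f"
      using mass_le_energy_plus_ball_mass[where N = N, OF v rho L2_diff_const[OF f, of "f v"]] k(2)[OF f]
      by (simp add: energy_diff_const algebra_simps)
    then have "(\<Sum>\<^sub>\<infinity>x\<in>V. vweight E C x * (f x - f v)\<^sup>2) / vol E C V
        \<le> (8 + 9 * k) * energy E C f / vol E C V"
      using vol_pos by (intro divide_right_mono) auto
    with L2_norm_le_diff_const[OF f mean, of "f v"] show ?thesis by simp
  qed
  moreover have "(8 + 9 * k) / vol E C V > 0" using k(1) vol_pos by simp
  ultimately show ?thesis by blast
qed

end

theorem theorem3p5:
  shows "\<exists>A::real. 0 < A \<and> A < 1 \<and>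
    (\<forall>(V :: 'v set) (E :: 'v set set) (C :: 'v \<Rightarrow> 'v \<Rightarrow> real) (v0 :: 'v).
       infinite_weighted_graph V E C \<longrightarrow> v0 \<in> V \<longrightarrow>
       limsup (\<lambda>n. ereal (rho V E C v0 n)) < ereal A \<longrightarrow>
       (\<exists>K::real. 0 < K \<and>
          (\<forall>f \<in> L2 (mu_measure V E C).
             L2_inner (mu_measure V E C) f (\<lambda>_. 1) = 0 \<longrightarrow>
             (L2_norm (mu_measure V E C) f)\<^sup>2 \<le> K * energy E C f)))"
proof (rule exI[of _ "1 / 4"], intro conjI allI impI)
  fix V :: "'v set" and E :: "'v set set" and C :: "'v \<Rightarrow> 'v \<Rightarrow> real" and v0 :: 'v
  assume g: "infinite_weighted_graph V E C" and v0: "v0 \<in> V"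
    and "limsup (\<lambda>n. ereal (rho V E C v0 n)) < ereal (1 / 4)"
  \<comment> \<open>The threshold \<open>1 / 4\<close> is the one for which the drift factor is 7/8
    < 1. A limit superior strictly below it leaves only finitely many exceptional spheres, which the
    ball of radius \<open>N\<close> absorbs.\<close>
  then have "\<forall>\<^sub>F n in sequentially. ereal (rho V E C v0 n) < ereal (1 / 4)"
    by (intro Limsup_lessD)
  then obtain N where "\<And>n. n \<ge> N \<Longrightarrow> rho V E C v0 n < 1 / 4"
    unfolding eventually_sequentially less_ereal.simps by blast
  then have "rho V E C v0 n \<le> 1 / 4" if "n > N" for n
    using that by (simp add: less_imp_le)
  from infinite_weighted_graph.poincare_inequality[OF g v0 this]
  show "\<exists>K::real. 0 < K \<and>
          (\<forall>f \<in> L2 (mu_measure V E C).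
             L2_inner (mu_measure V E C) f (\<lambda>_. 1) = 0 \<longrightarrow>
             (L2_norm (mu_measure V E C) f)\<^sup>2 \<le> K * energy E C f)"
    by blast
qed simp_all

end
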